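(* Let $(X,d)$ be a nonempty compact metric space and let $T:X\to X$ be continuous. If $X$ is a finite set, then $D_{pre}(T)=0$.
   Context: For $n\in\mathbb{N}=\{1,2,\dots\}$ put $d_{T,n}(x,y)=\max_{0\le j<n}d(T^j(x),T^j(y))$. For $K\subseteq X$ and $\epsilon>0$, a set $E\subseteq K$ is an $(n,\epsilon,K,T)$-separated set if $d_{T,n}(x,y)>\epsilon$ for all $x\ne y$ in $E$; $r(n,\epsilon,K,T)$ denotes the maximal cardinality of an $(n,\epsilon,K,T)$-separated subset of $K$. Here $T^{-k}(x)=\{y\in X: T^k(y)=x\}$. For real $s>0$, the $s$-preimage entropy of $T$ is $$D_{pre}(s,T)=\lim_{\epsilon\to 0}\limsup_{n\to\infty}\frac{1}{n^s}\log\sup_{x\in X,\,k\ge n}r(n,\epsilon,T^{-k}(x),T)\in[0,+\infty],$$ and the preimage entropy dimension of $T$ is $$D_{pre}(T)=\inf\{s>0: D_{pre}(s,T)=0\}=\sup\{s>0: D_{pre}(s,T)=\infty\}\in[0,+\infty]$$ (with $\inf\emptyset=+\infty$ and $\sup\emptyset=0$). *)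

theory Defs
  imports "HOL-Analysis.Analysis"
begin

text \<open>
  The system is a compact set \<open>X\<close> in a metric space together with a map \<open>T\<close> that is continuous
  on \<open>X\<close> and maps \<open>X\<close> into itself; \<open>T\<close> is irrelevant outside \<open>X\<close>.
\<close>

text \<open>Only meaningful for \<open>n \<ge> 1\<close>: for \<open>n = 0\<close> the maximum is over the empty set.\<close>

definition bowen_dist :: "('a::metric_space \<Rightarrow> 'a) \<Rightarrow> nat \<Rightarrow> 'a \<Rightarrow> 'a \<Rightarrow> real" where
  "bowen_dist T n x y = Max ((\<lambda>j. dist ((T ^^ j) x) ((T ^^ j) y)) ` {..<n})"

definition separated :: "nat \<Rightarrow> real \<Rightarrow> 'a::metric_space set \<Rightarrow> ('a \<Rightarrow> 'a) \<Rightarrow> 'a set \<Rightarrow> bool" where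
  "separated n \<epsilon> K T E \<longleftrightarrow>
     E \<subseteq> K \<and> (\<forall>x\<in>E. \<forall>y\<in>E. x \<noteq> y \<longrightarrow> bowen_dist T n x y > \<epsilon>)"

text \<open>
  The maximal cardinality, as a supremum in \<^typ>\<open>enat\<close>. Subsets of separated sets are separated,
  so restricting to finite sets (where \<^const>\<open>card\<close> is the cardinality) loses nothing: an
  infinite separated set makes the supremum \<open>\<infinity>\<close>.
\<close>

definition max_separated :: "nat \<Rightarrow> real \<Rightarrow> 'a::metric_space set \<Rightarrow> ('a \<Rightarrow> 'a) \<Rightarrow> enat" where
  "max_separated n \<epsilon> K T = (SUP E\<in>{E. finite E \<and> separated n \<epsilon> K T E}. enat (card E))"

definition preimage_set :: "'a set \<Rightarrow> ('a \<Rightarrow> 'a) \<Rightarrow> nat \<Rightarrow> 'a \<Rightarrow> 'a set" where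
  "preimage_set X T k x = {y \<in> X. (T ^^ k) y = x}"

text \<open>The natural logarithm with the conventions \<open>log 0 = -\<infinity>\<close> and \<open>log \<infinity> = \<infinity>\<close>.\<close>

definition log_enat :: "enat \<Rightarrow> ereal" where
  "log_enat N = (case N of enat m \<Rightarrow> (if m = 0 then -\<infinity> else ereal (ln (real m))) | \<infinity> \<Rightarrow> \<infinity>)"

definition preimage_entropy :: "'a::metric_space set \<Rightarrow> real \<Rightarrow> ('a \<Rightarrow> 'a) \<Rightarrow> ereal" where
  "preimage_entropy X s T =
     Lim (at_right 0) (\<lambda>\<epsilon>::real.
       limsup (\<lambda>n. ereal (1 / real n powr s) *
         log_enat (SUP x\<in>X. SUP k\<in>{n..}. max_separated n \<epsilon> (preimage_set X T k x) T)))"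

text \<open>The infimum is taken in \<^typ>\<open>ereal\<close>, so that the infimum of the empty set is \<open>\<infinity>\<close>.\<close>

definition preimage_entropy_dim :: "'a::metric_space set \<Rightarrow> ('a \<Rightarrow> 'a) \<Rightarrow> ereal" where
  "preimage_entropy_dim X T = Inf (ereal ` {s. s > 0 \<and> preimage_entropy X s T = 0})"

end

theory Submission
  imports Defs
begin

text \<open>
  A fibre \<open>T\<^sup>-\<^sup>k x\<close> has at most \<open>card X\<close> points, and it is nonempty for \<open>x = T\<^sup>n y\<close>, \<open>k = n\<close>. So the
  logarithm in the definition of the entropy stays between \<open>0\<close> and \<open>ln (card X)\<close>, and division by
  \<open>n\<^sup>s\<close> sends it to \<open>0\<close> for every \<open>s > 0\<close>.
\<close>

text \<open>The lower bound rules out the value -\<infinity> at 0 and the upper bound rules out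
  \<infinity>, so only the real logarithm, which is monotone, remains.\<close>

lemma log_enat_bounds:
  assumes "1 \<le> N" and "N \<le> enat m"
  shows "0 \<le> log_enat N" and "log_enat N \<le> ereal (ln (real m))"
proof -
  obtain p where p: "N = enat p" "1 \<le> p" "p \<le> m"
    using assms by (cases N) (auto simp: one_enat_def)
  then show "0 \<le> log_enat N" and "log_enat N \<le> ereal (ln (real m))"
    by (auto simp: log_enat_def)
qed

lemma max_separated_le_card:
  assumes "finite X" and "K \<subseteq> X"
  shows "max_separated n \<epsilon> K T \<le> enat (card X)"
  unfolding max_separated_def
  using assms by (auto intro!: SUP_least card_mono simp: separated_def subset_iff)

text \<open>A singleton is separated vacuously, having no two distinct points.\<close>

lemma max_separated_ge_1:
  assumes "y \<in> K"
  shows "1 \<le> max_separated n \<epsilon> K T"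
proof -
  have "{y} \<in> {E. finite E \<and> separated n \<epsilon> K T E}"
    using assms by (simp add: separated_def)
  then have "enat (card {y}) \<le> max_separated n \<epsilon> K T"
    unfolding max_separated_def by (rule SUP_upper)
  then show ?thesis
    by (simp add: one_enat_def)
qed

lemma funpow_image_subset:
  assumes "T ` X \<subseteq> X" and "y \<in> X"
  shows "(T ^^ n) y \<in> X"
  using assms by (induction n) auto

lemma SUP_max_separated_preimage_bounds:
  fixes X :: "'a::metric_space set"
  assumes "X \<noteq> {}" and "T ` X \<subseteq> X" and "finite X"
  defines "S \<equiv> \<lambda>n \<epsilon>. SUP x\<in>X. SUP k\<in>{n..}. max_separated n \<epsilon> (preimage_set X T k x) T"
  shows "1 \<le> S n \<epsilon>" and "S n \<epsilon> \<le> enat (card X)"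
proof -
  obtain y where y: "y \<in> X"
    using assms(1) by blast
  have "1 \<le> max_separated n \<epsilon> (preimage_set X T n ((T ^^ n) y)) T"
    by (rule max_separated_ge_1[of y]) (simp add: preimage_set_def y)
  also have "\<dots> \<le> (SUP k\<in>{n..}. max_separated n \<epsilon> (preimage_set X T k ((T ^^ n) y)) T)"
    by (rule SUP_upper) simp
  also have "\<dots> \<le> S n \<epsilon>"
    unfolding S_def
    \<comment> \<open>Invariance of \<open>X\<close> makes the base point \<open>(T ^^ n) y\<close>
      an index of the outer supremum.\<close>
    using funpow_image_subset[OF assms(2) y, of n]
    by (rule SUP_upper)
  finally show "1 \<le> S n \<epsilon>" .
  show "S n \<epsilon> \<le> enat (card X)"
    unfolding S_def
    by (intro SUP_least max_separated_le_card[OF assms(3)]) (auto simp: preimage_set_def)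
qed

lemma preimage_entropy_finite:
  fixes X :: "'a::metric_space set"
  assumes "X \<noteq> {}" and "T ` X \<subseteq> X" and "finite X" and "s > 0"
  shows "preimage_entropy X s T = 0"
proof -
  define S where
    "S n \<epsilon> = (SUP x\<in>X. SUP k\<in>{n..}. max_separated n \<epsilon> (preimage_set X T k x) T)" for n \<epsilon>
  have S: "1 \<le> S n \<epsilon>" "S n \<epsilon> \<le> enat (card X)" for n \<epsilon>
    unfolding S_def by (rule SUP_max_separated_preimage_bounds[OF assms(1-3)])+
  have "limsup (\<lambda>n. ereal (1 / real n powr s) * log_enat (S n \<epsilon>)) = 0" for \<epsilon>
  proof -
    \<comment> \<open>The factor is \<open>real n powr (- s)\<close>, whose exponent is
      negative.\<close>
    have "(\<lambda>n. (1 / real n powr s) * ln (real (card X))) \<longlonglongrightarrow> 0 * ln (real (card X))"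
      using tendsto_neg_powr[OF _ filterlim_real_sequentially, of "- s"] assms(4)
      by (intro tendsto_intros) (simp add: powr_minus_divide)
    then have lim: "(\<lambda>n. ereal ((1 / real n powr s) * ln (real (card X)))) \<longlonglongrightarrow> 0"
      by (simp add: zero_ereal_def)
    have "(\<lambda>n. ereal (1 / real n powr s) * log_enat (S n \<epsilon>)) \<longlonglongrightarrow> 0"
    \<comment> \<open>Both bounds hold at every \<open>n\<close>, even at \<open>n = 0\<close>,
      where the factor \<open>1 / real n powr s\<close> is 0 by the convention for division.\<close>
    proof (rule tendsto_sandwich[OF _ _ tendsto_const lim])
      show "\<forall>\<^sub>F n in sequentially. 0 \<le> ereal (1 / real n powr s) * log_enat (S n \<epsilon>)"
        using log_enat_bounds(1)[OF S] by (intro always_eventually allI) simp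
      show "\<forall>\<^sub>F n in sequentially. ereal (1 / real n powr s) * log_enat (S n \<epsilon>)
              \<le> ereal ((1 / real n powr s) * ln (real (card X)))"
        unfolding times_ereal.simps(1)[symmetric]
        using log_enat_bounds(2)[OF S]
        by (intro always_eventually allI ereal_mult_left_mono) simp_all
    qed
    then show ?thesis
      by (intro lim_imp_Limsup) simp_all
  qed
  \<comment> \<open>The limsup is 0 for each \<open>\<epsilon>\<close>, so the limit at 0 from the
    right is that of a constant function.\<close>
  then show ?thesis
    unfolding preimage_entropy_def S_def[symmetric]
    by (simp add: tendsto_Lim)
qed

theorem proposition2p3:
  fixes X :: "'a::metric_space set" and T :: "'a \<Rightarrow> 'a"
  assumes "X \<noteq> {}" and "compact X"
    and "continuous_on X T" and "T ` X \<subseteq> X"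
    and "finite X"
  shows "preimage_entropy_dim X T = 0"
proof -
  have "preimage_entropy_dim X T = Inf (ereal ` {0<..})"
    unfolding preimage_entropy_dim_def
    using preimage_entropy_finite[OF assms(1,4,5)]
    by (intro arg_cong[where f = Inf] image_cong) auto
  also have "\<dots> = 0"
  proof (rule antisym)
    show "0 \<le> Inf (ereal ` {0<..})"
      by (intro INF_greatest) simp
    \<comment> \<open>The infimum is not attained; it is at most \<open>0 + e\<close> for each real
      \<open>e > 0\<close>, because \<open>e\<close> itself belongs to the set.\<close>
    show "Inf (ereal ` {0<..}) \<le> 0"
      by (rule ereal_le_epsilon2) (auto intro: INF_lower)
  qed
  finally show ?thesis .
qed

end
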